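(* Assume the Continuum Hypothesis. Then there exist a total ordering $\preceq$ on the set $\mathcal{O} := (0,1)$ and an increasing $\mathcal{O}$-family $(A_t)_{t\in\mathcal{O}}$ of Borel subsets of $(0,1)$ (with $\bigcup_{t\in(0,1)}A_t$ Borel, so that its measure is defined) such that $$\mathrm{Leb}\left(\bigcup_{t\in(0,1)} A_t\right) > \sup_{t\in(0,1)}\mathrm{Leb}(A_t).$$
   Context: $\mathrm{Leb}$ denotes Lebesgue measure on $((0,1),\mathcal{B}((0,1)))$, where $\mathcal{B}((0,1))$ is the Borel $\sigma$-algebra. The ordering $\preceq$ on $(0,1)$ need not be the standard one. Given a totally ordered index set $(\mathcal{O},\preceq)$, an increasing $\mathcal{O}$-family of Borel sets is a collection $(A_t)_{t\in\mathcal{O}}$ of Borel sets such that $A_s\subseteq A_t$ whenever $s\preceq t$. The Continuum Hypothesis is the statement that for every uncountably infinite set $S$ there exists an injection $g\colon\mathbb{R}\to S$; equivalently, $|\mathbb{R}|=\aleph_1$. *)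

theory Defs
  imports "HOL-Analysis.Analysis"
begin

unbundle cardinal_syntax

text \<open>A formula of HOL cannot quantify over types, so the sets \<open>S\<close> here are sets of reals.
  The two lemmas below recover the statement for uncountable sets of any type and the
  formulation with the first uncountable cardinal.\<close>

definition Continuum_Hypothesis :: bool where
  "Continuum_Hypothesis \<longleftrightarrow>
     (\<forall>S :: real set. uncountable S \<longrightarrow> (\<exists>g :: real \<Rightarrow> real. inj g \<and> range g \<subseteq> S))"

lemma Continuum_Hypothesis_any_type:
  fixes S :: "'a set"
  assumes CH: Continuum_Hypothesis and S: "uncountable S"
  shows "\<exists>g :: real \<Rightarrow> 'a. inj g \<and> range g \<subseteq> S"
proof (rule ccontr)
  assume no: "\<not> ?thesis"
  have "\<not> |UNIV :: real set| \<le>o |S|"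
    using no card_of_ordLeq[of "UNIV :: real set" S] by blast
  then have "|S| \<le>o |UNIV :: real set|"
    using ordLess_imp_ordLeq ordLess_or_ordLeq[OF card_of_Well_order card_of_Well_order] by blast
  then obtain f :: "'a \<Rightarrow> real" where f: "inj_on f S"
    using card_of_ordLeq[of S "UNIV :: real set"] by blast
  have "uncountable (f ` S)"
    using S f countable_image_inj_on by blast
  then obtain g :: "real \<Rightarrow> real" where g: "inj g" "range g \<subseteq> f ` S"
    using CH unfolding Continuum_Hypothesis_def by blast
  have "inj (inv_into S f \<circ> g)"
    using g by (meson comp_inj_on inj_on_inv_into)
  moreover have "range (inv_into S f \<circ> g) \<subseteq> S"
    using g(2) by (auto intro!: inv_into_into)
  ultimately show False using no by blast
qed

lemma Continuum_Hypothesis_iff_aleph1: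
  "Continuum_Hypothesis \<longleftrightarrow> |UNIV :: real set| =o cardSuc natLeq"
proof
  have countable_natLeq: "countable S \<longleftrightarrow> |S| \<le>o natLeq" for S :: "'b set"
    using card_of_ordLeq[of S "UNIV :: nat set"] ordLeq_ordIso_trans[OF _ card_of_nat]
      ordLeq_ordIso_trans[OF _ ordIso_symmetric[OF card_of_nat]]
    by (auto simp: countable_def)
  have aleph1_le: "cardSuc natLeq \<le>o |S|" if "uncountable S" for S :: "'b set"
    using that ordLess_or_ordLeq[OF natLeq_Well_order card_of_Well_order]
      cardSuc_least[OF natLeq_Card_order card_of_Card_order]
    unfolding countable_natLeq by blast
  have field: "|Field (cardSuc natLeq)| =o cardSuc natLeq"
    by (simp add: card_of_Field_ordIso cardSuc_Card_order natLeq_Card_order)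
  show "|UNIV :: real set| =o cardSuc natLeq" if CH: Continuum_Hypothesis
  proof -
    have "natLeq <o |Field (cardSuc natLeq)|"
      by (rule ordLess_ordIso_trans[OF cardSuc_greater[OF natLeq_Card_order] ordIso_symmetric[OF field]])
    then have "uncountable (Field (cardSuc natLeq))"
      unfolding countable_natLeq using not_ordLess_ordLeq by blast
    then have "|UNIV :: real set| \<le>o |Field (cardSuc natLeq)|"
      using Continuum_Hypothesis_any_type[OF CH] unfolding card_of_ordLeq[symmetric] by blast
    then have "|UNIV :: real set| \<le>o cardSuc natLeq"
      by (rule ordLeq_ordIso_trans[OF _ field])
    moreover have "cardSuc natLeq \<le>o |UNIV :: real set|"
      using aleph1_le uncountable_UNIV_real by blast
    ultimately show ?thesis
      by (simp add: ordIso_iff_ordLeq)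
  qed
  show Continuum_Hypothesis if "|UNIV :: real set| =o cardSuc natLeq"
    unfolding Continuum_Hypothesis_def card_of_ordLeq
    using ordIso_ordLeq_trans[OF that aleph1_le] by blast
qed

unbundle no cardinal_syntax

text \<open>Lebesgue measure on the Borel sets of the open unit interval; \<open>lborel\<close> lives on the
  Borel (not the Lebesgue) sigma-algebra of the line.\<close>

abbreviation Leb :: "real measure" where
  "Leb \<equiv> restrict_space lborel {0<..<1}"

definition increasing_family :: "'a measure \<Rightarrow> 'i set \<Rightarrow> 'i rel \<Rightarrow> ('i \<Rightarrow> 'a set) \<Rightarrow> bool" where
  "increasing_family M I r A \<longleftrightarrow>
     (\<forall>t\<in>I. A t \<in> sets M) \<and> monotone_on I (\<lambda>s t. (s, t) \<in> r) (\<subseteq>) A"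

end

theory Submission
  imports Defs
begin

text \<open>Order the interval by a well-ordering of least possible order type, the initial ordinal of
  its cardinality. Every proper initial segment then has cardinality below the continuum, so under
  the Continuum Hypothesis it is countable and therefore null. The closed initial segments form an
  increasing family of null sets, yet they exhaust the interval, which has measure 1: continuity
  from below fails because no countable subfamily is cofinal.\<close>

unbundle cardinal_syntax

text \<open>An uncountable initial segment would, by the Continuum Hypothesis, contain an injective copy
  of the real line and hence be as large as the whole well-ordered set, which a cardinal
  well-ordering forbids.\<close>

lemma CH_countable_initial_segment:
  fixes X :: "real set"
  assumes CH: Continuum_Hypothesis and t: "t \<in> X"
  shows "countable (under (card_of X) t)"
proof -
  have less: "card_of (underS (card_of X) t) <o card_of X"
    using card_of_underS[OF card_of_Card_order, of t X] t by (simp add: Field_card_of)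
  have "countable (underS (card_of X) t)"
  proof (rule ccontr)
    assume "uncountable (underS (card_of X) t)"
    then have "card_of (UNIV :: real set) \<le>o card_of (underS (card_of X) t)"
      using CH unfolding Continuum_Hypothesis_def card_of_ordLeq[symmetric] by blast
    then have "card_of X \<le>o card_of (underS (card_of X) t)"
      by (rule ordLeq_transitive[OF card_of_mono1[OF subset_UNIV]])
    then show False
      using less not_ordLess_ordLeq by blast
  qed
  then have "countable (insert t (underS (card_of X) t))"
    by simp
  then show ?thesis
    by (rule countable_subset[rotated]) (auto simp: under_def underS_def)
qed

unbundle no cardinal_syntax

theorem theorem3:
  assumes Continuum_Hypothesis
  shows "\<exists>(r :: real rel) (A :: real \<Rightarrow> real set).
           linear_order_on {0<..<1} r \<and>
           increasing_family Leb {0<..<1} r A \<and>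
           (\<Union>t\<in>{0<..<1}. A t) \<in> sets Leb \<and>
           emeasure Leb (\<Union>t\<in>{0<..<1}. A t) > (SUP t\<in>{0<..<1}. emeasure Leb (A t))"
proof -
  define I :: "real set" where "I = {0<..<1}"
  define A where "A = under (card_of I)"
  have I: "I \<in> sets lborel"
    by (simp add: I_def)
  have lin: "linear_order_on I (card_of I)"
    using card_of_well_order_on[of I] by (simp add: well_order_on_def)
  then have refl: "refl_on I (card_of I)" and trans: "trans (card_of I)"
    by (simp_all add: order_on_defs)
  have sub: "A t \<subseteq> I" for t
    using under_Field[of "card_of I" t] by (simp add: A_def Field_card_of)
  have count: "countable (A t)" if "t \<in> I" for t
    unfolding A_def using CH_countable_initial_segment[OF assms that] .
  have sets: "A t \<in> sets Leb" if "t \<in> I" for t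
    using sub[of t] null_setsD2[OF countable_imp_null_set_lborel[OF count[OF that]]] I
    by (simp add: sets_restrict_space_iff flip: I_def)
  have null: "emeasure Leb (A t) = 0" if "t \<in> I" for t
    using sub[of t] emeasure_lborel_countable[OF count[OF that]] I
    by (simp add: emeasure_restrict_space flip: I_def)
  have "increasing_family Leb I (card_of I) A"
    using sets under_incr[OF trans]
    unfolding increasing_family_def monotone_on_def A_def by blast
  moreover have Un: "(\<Union>t\<in>I. A t) = I"
  proof
    show "(\<Union>t\<in>I. A t) \<subseteq> I"
      using sub by blast
    show "I \<subseteq> (\<Union>t\<in>I. A t)"
      using refl unfolding A_def under_def refl_on_def by blast
  qed
  moreover have "emeasure Leb I = 1"
    by (simp add: emeasure_restrict_space I_def)
  moreover have "I \<in> sets Leb"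
    using I by (simp add: sets_restrict_space_iff flip: I_def)
  moreover have "(SUP t\<in>I. emeasure Leb (A t)) = 0"
  proof (rule SUP_eq_const)
    show "I \<noteq> {}"
      by (simp add: I_def)
  qed (rule null)
  ultimately show ?thesis
    using lin unfolding I_def[symmetric]
    by (intro exI[of _ "card_of I"] exI[of _ A]) (simp only: zero_less_one simp_thms)
qed

end
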